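(* Let $s:\mathbb{R}\to\mathbb{C}$ be a sufficiently smooth regular planar curve, let $u,\varepsilon\in\mathbb{R}$, and let $\gamma:\mathbb{Z}\to\mathbb{C}$ be the discrete curve $\gamma_k=s(u+(2k-1)\varepsilon)$. Let $T_0$ and $N_0$ be the unit tangent vector and the unit normal vector of the discrete curvature circle $k_0$ of $\gamma$ (at the edge $\gamma_0\gamma_1$) at the point $p_{\gamma_0\gamma_1}=f(\gamma_{-1},\gamma_0,\gamma_1,\gamma_2)$. Then, after appropriate orientation (choice of signs) of $T_0$ and $N_0$, as $\varepsilon\to0$ (with $\varepsilon\neq 0$), $$T_0=T+O(\varepsilon^2)\quad\text{and}\quad N_0=N+O(\varepsilon^2),$$ where $T$ and $N$ are the unit tangent vector and the unit normal vector of $s$ at $u$.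
   Context: Regular means $s'\neq 0$ everywhere; sufficiently smooth means of class $C^k$ with $k$ large enough. $T=s'/|s'|$ and $N=i\,s'/|s'|$. For pairwise distinct $a,b,c,d\in\mathbb{C}$ put $\mathrm{cr}(a,b,c,d)=\frac{(a-b)(c-d)}{(b-c)(d-a)}$ and $$f(a,b,c,d)=\frac{c(b-a)\sqrt{\mathrm{cr}(c,a,b,d)}+b(c-a)}{(b-a)\sqrt{\mathrm{cr}(c,a,b,d)}+(c-a)}\in\mathbb{C}\cup\{\infty\},$$ with the principal square root (value $\infty$ when the denominator vanishes). The four points $f(d,a,b,c),\ f(a,b,c,d),\ f(b,c,d,a),\ f(c,d,a,b)$ always lie on a common circle (a line together with $\infty$ counts as a circle). The discrete curvature circle $k_i$ of $\gamma$ at the edge $\gamma_i\gamma_{i+1}$ is this circle for $(a,b,c,d)=(\gamma_{i-1},\gamma_i,\gamma_{i+1},\gamma_{i+2})$ (assumed pairwise distinct, which holds for the sampled points when $\varepsilon\ne0$ is small). *)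

theory Defs
  imports "HOL-Analysis.Analysis" "HOL-Library.Landau_Symbols"
begin

definition iter_vderiv :: "nat \<Rightarrow> (real \<Rightarrow> complex) \<Rightarrow> real \<Rightarrow> complex" where
  "iter_vderiv j s = ((\<lambda>g t. vector_derivative g (at t)) ^^ j) s"

definition class_C :: "nat \<Rightarrow> (real \<Rightarrow> complex) \<Rightarrow> bool" where
  "class_C k s \<longleftrightarrow>
     (\<forall>j<k. \<forall>t. iter_vderiv j s differentiable (at t)) \<and> continuous_on UNIV (iter_vderiv k s)"

definition regular_curve :: "(real \<Rightarrow> complex) \<Rightarrow> bool" where
  "regular_curve s \<longleftrightarrow> (\<forall>t. s differentiable (at t) \<and> vector_derivative s (at t) \<noteq> 0)"

definition curve_tangent :: "(real \<Rightarrow> complex) \<Rightarrow> real \<Rightarrow> complex" where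
  "curve_tangent s u =
     vector_derivative s (at u) / of_real (norm (vector_derivative s (at u)))"

definition curve_normal :: "(real \<Rightarrow> complex) \<Rightarrow> real \<Rightarrow> complex" where
  "curve_normal s u =
     \<i> * vector_derivative s (at u) / of_real (norm (vector_derivative s (at u)))"

definition cr :: "complex \<Rightarrow> complex \<Rightarrow> complex \<Rightarrow> complex \<Rightarrow> complex" where
  "cr a b c d = ((a - b) * (c - d)) / ((b - c) * (d - a))"

text \<open>
  The extended plane is modelled by \<^typ>\<open>complex option\<close>, with \<^term>\<open>None\<close> as the
  point at infinity. \<^const>\<open>csqrt\<close> is the principal square root.
\<close>

definition edge_point :: "complex \<Rightarrow> complex \<Rightarrow> complex \<Rightarrow> complex \<Rightarrow> complex option" where
  "edge_point a b c d =
     (let w = csqrt (cr c a b d);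
          num = c * (b - a) * w + b * (c - a);
          den = (b - a) * w + (c - a)
      in if den = 0 then None else Some (num / den))"

definition round_circle :: "complex \<Rightarrow> real \<Rightarrow> complex option set" where
  "round_circle m r = Some ` sphere m r"

definition extended_line :: "complex \<Rightarrow> complex \<Rightarrow> complex option set" where
  "extended_line x y = insert None (Some ` (affine hull {x, y}))"

definition generalized_circle :: "complex option set \<Rightarrow> bool" where
  "generalized_circle K \<longleftrightarrow>
     (\<exists>m r. r > 0 \<and> K = round_circle m r) \<or> (\<exists>x y. x \<noteq> y \<and> K = extended_line x y)"

text \<open>
  For pairwise distinct arguments the four edge points are pairwise distinct (they are the
  fixed points of two different commuting Moebius involutions), so at most one generalized
  circle contains them. For other arguments the value is unspecified.
\<close>

definition curvature_circle ::
    "complex \<Rightarrow> complex \<Rightarrow> complex \<Rightarrow> complex \<Rightarrow> complex option set" where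
  "curvature_circle a b c d =
     (THE K. generalized_circle K \<and>
        {edge_point d a b c, edge_point a b c d, edge_point b c d a, edge_point c d a b} \<subseteq> K)"

definition discrete_curvature_circle :: "(int \<Rightarrow> complex) \<Rightarrow> int \<Rightarrow> complex option set" where
  "discrete_curvature_circle \<gamma> i =
     curvature_circle (\<gamma> (i - 1)) (\<gamma> i) (\<gamma> (i + 1)) (\<gamma> (i + 2))"

definition unit_tangent_at :: "complex option set \<Rightarrow> complex \<Rightarrow> complex \<Rightarrow> bool" where
  "unit_tangent_at K p v \<longleftrightarrow> norm v = 1 \<and> Some p \<in> K \<and>
     ((\<exists>m r. r > 0 \<and> K = round_circle m r \<and> (p - m) \<bullet> v = 0) \<or>
      (\<exists>x y. x \<noteq> y \<and> K = extended_line x y \<and> (\<exists>t::real. v = t *\<^sub>R (y - x))))"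

definition unit_normal_at :: "complex option set \<Rightarrow> complex \<Rightarrow> complex \<Rightarrow> bool" where
  "unit_normal_at K p n \<longleftrightarrow> norm n = 1 \<and> (\<exists>v. unit_tangent_at K p v \<and> n \<bullet> v = 0)"

definition sampled_curve :: "(real \<Rightarrow> complex) \<Rightarrow> real \<Rightarrow> real \<Rightarrow> int \<Rightarrow> complex" where
  "sampled_curve s u \<epsilon> k = s (u + (2 * of_int k - 1) * \<epsilon>)"

end

theory Submission
  imports Defs
begin

text \<open>
  Let $a, b, c, d$ be distinct and let $p = f(a,b,c,d)$ be finite. Send $p$ to infinity by
  $\psi(z) = 1/(z - p)$. Edge points commute with this inversion, and $p$ is a fixed point of the
  Moebius involution exchanging $a \leftrightarrow d$ and $b \leftrightarrow c$. That involution
  becomes one that fixes infinity, hence the reflection in a point $m$: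
  $\psi(a) + \psi(d) = \psi(b) + \psi(c) = 2m$. The opposite edge point $f(c,d,a,b)$ is the other
  fixed point $m$, and the two remaining edge points, the fixed points of the involution exchanging
  $\psi(a) \leftrightarrow \psi(b)$ and $\psi(c) \leftrightarrow \psi(d)$, are $m \pm e$ with
  $4e^2 = (\psi(a) - \psi(d))(\psi(b) - \psi(c))$. The points $m$, $m + e$, $m - e$ lie on exactly
  one line, so exactly one generalized circle contains the four edge points. The circles through
  $p$ with unit tangent $v$ at $p$ are the preimages of the lines $\mathrm{Im}(v\zeta) = k$, so $v$
  is tangent to the curvature circle as soon as $ve$ is real, that is as soon as
  $v^2 (\psi(a) - \psi(d))(\psi(b) - \psi(c))$ is positive. This is
  \<open>unit_tangent_at_curvature_circle\<close>.

  For the asymptotics write the samples as $s(u + k\varepsilon) = s(u) + \kappa q_k$ with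
  $\kappa = s'(u)\varepsilon$ and $k \in \{-3,-1,1,3\}$, and let $P$ be the edge point of the
  $q_k$. Two facts suffice: $q_k = k + O(\varepsilon)$, which gives $P = O(\varepsilon)$
  (\<open>edge_point_symmetric_quadruple\<close>), and $q_k - q_{-k} = 2k + O(\varepsilon^2)$, because
  the quadratic Taylor term of $s$ cancels in a symmetric difference. If
  $Y = q_{-k} + k - P = O(\varepsilon)$ then
  $(q_{-k} - P)(q_k - P) = (Y - k)(Y + k + O(\varepsilon^2)) = -k^2 + O(\varepsilon^2)$, without a
  term of order $\varepsilon$, and so
  \[ \frac{1}{\frac{1}{q_{-k} - P} - \frac{1}{q_k - P}} = -\frac{k}{2} + O(\varepsilon^2) \]
  (\<open>bigo_symmetric_pair\<close>). The product $R$ of these quantities for $k = 3$ and $k = 1$ is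
  $3/4 + O(\varepsilon^2)$, and the squared tangent direction is a positive multiple of
  $s'(u)^2 R$. Taking the principal root, the unit tangent is
  $s'(u)/|s'(u)|$ times $1 + O(\varepsilon^2)$; the normal is $\mathrm{i}$ times the tangent.
\<close>

section \<open>Generalized circles through a point as preimages of lines\<close>

text \<open>
  The centre $p$ goes to infinity and infinity to $0$, so that circles through $p$ correspond to
  lines.
\<close>
definition inversion :: "complex \<Rightarrow> complex option \<Rightarrow> complex option" where
  "inversion p X = (case X of None \<Rightarrow> Some 0
     | Some z \<Rightarrow> if z = p then None else Some (1 / (z - p)))"

text \<open>
  In the coordinate $\zeta = 1/(z - p)$ this is the line $\mathrm{Im}(v\zeta) = k$ together with
  infinity; for a unit vector $v$ it is a circle of curvature $2|k|$ (a line if $k = 0$) through $p$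
  with tangent $v$.
\<close>
definition tangent_circle :: "complex \<Rightarrow> complex \<Rightarrow> real \<Rightarrow> complex option set" where
  "tangent_circle p v k =
     {X. case inversion p X of None \<Rightarrow> True | Some \<zeta> \<Rightarrow> Im (v * \<zeta>) = k}"

lemma Some_in_tangent_circle:
  "Some z \<in> tangent_circle p v k \<longleftrightarrow> z = p \<or> Im (v / (z - p)) = k"
  by (simp add: tangent_circle_def inversion_def)

lemma None_in_tangent_circle: "None \<in> tangent_circle p v k \<longleftrightarrow> k = 0"
  by (auto simp: tangent_circle_def inversion_def)

lemma tangent_circle_uminus: "tangent_circle p (-v) (-k) = tangent_circle p v k"
  by (auto simp: tangent_circle_def split: option.splits)

lemma Im_divide_eq_iff:
  assumes "y \<noteq> 0"
  shows "Im (v / y) = k \<longleftrightarrow> Im (v * cnj y) = k * (norm y)\<^sup>2"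
proof -
  have "v / y = v * cnj y / of_real ((norm y)\<^sup>2)"
    using assms by (simp only: complex_norm_square) simp
  then have *: "Im (v / y) = Im (v * cnj y) / (norm y)\<^sup>2"
    by (metis Im_divide_of_real)
  show ?thesis unfolding * using assms by (simp add: divide_eq_eq)
qed

text \<open>
  With $y = z - p$ the condition reads $\mathrm{Im}(v\bar y) = k|y|^2$; completing the square gives
  the centre and the radius.
\<close>
lemma tangent_circle_eq_round_circle:
  assumes "norm v = 1" "k \<noteq> 0"
  shows "tangent_circle p v k =
    round_circle (p - \<i> * v / of_real (2 * k)) (1 / (2 * \<bar>k\<bar>))"
proof -
  have *: "z = p \<or> Im (v / (z - p)) = k \<longleftrightarrow>
    norm (p - \<i> * v / of_real (2 * k) - z) = 1 / (2 * \<bar>k\<bar>)" for z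
  proof -
    define y where "y = z - p"
    have v: "(Re v)\<^sup>2 + (Im v)\<^sup>2 = 1" using assms(1) by (simp add: cmod_def)
    have "(norm (p - \<i> * v / of_real (2 * k) - z))\<^sup>2 = (norm (\<i> * v / of_real (2 * k) + y))\<^sup>2"
      by (subst norm_minus_cancel [symmetric]) (simp add: y_def algebra_simps)
    also have "\<dots> = (Re y - Im v / (2 * k))\<^sup>2 + (Im y + Re v / (2 * k))\<^sup>2"
      by (simp add: cmod_power2 Re_divide_of_real Im_divide_of_real add.commute del: of_real_mult)
    also have "\<dots> = (norm y)\<^sup>2 + ((Re v)\<^sup>2 + (Im v)\<^sup>2) / (2 * k)\<^sup>2 - Im (v * cnj y) / k"
      unfolding cmod_power2[of y] using assms(2) by (simp add: power2_eq_square field_simps)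
    finally have n: "(norm (p - \<i> * v / of_real (2 * k) - z))\<^sup>2 =
      (norm y)\<^sup>2 + (1 / (2 * \<bar>k\<bar>))\<^sup>2 - Im (v * cnj y) / k"
      by (simp add: v power_divide power_mult_distrib)
    have cancel_rhs: "x + r - i / k = r \<longleftrightarrow> i = k * x" for x r i :: real
      using assms(2) by (auto simp: field_simps)
    have "norm (p - \<i> * v / of_real (2 * k) - z) = 1 / (2 * \<bar>k\<bar>) \<longleftrightarrow>
      (norm (p - \<i> * v / of_real (2 * k) - z))\<^sup>2 = (1 / (2 * \<bar>k\<bar>))\<^sup>2"
      by (subst power2_eq_iff_nonneg) auto
    also have "\<dots> \<longleftrightarrow> Im (v * cnj y) = k * (norm y)\<^sup>2"
      unfolding n using assms(2) by (simp only: cancel_rhs)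
    also have "\<dots> \<longleftrightarrow> z = p \<or> Im (v / (z - p)) = k"
      using Im_divide_eq_iff[of y v k] by (cases "y = 0") (auto simp: y_def)
    finally show ?thesis by blast
  qed
  show ?thesis
  proof (intro set_eqI)
    fix X show "X \<in> tangent_circle p v k \<longleftrightarrow>
      X \<in> round_circle (p - \<i> * v / of_real (2 * k)) (1 / (2 * \<bar>k\<bar>))"
    proof (cases X)
      case None
      with assms(2) show ?thesis by (auto simp: round_circle_def None_in_tangent_circle)
    next
      case (Some z)
      have "Some z \<in> round_circle m r \<longleftrightarrow> norm (m - z) = r" for m r
        by (auto simp: round_circle_def dist_norm)
      then show ?thesis unfolding Some Some_in_tangent_circle * by blast
    qed
  qed
qed

lemma tangent_circle_eq_extended_line:
  assumes "v \<noteq> 0"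
  shows "tangent_circle p v 0 = extended_line p (p + v)"
proof -
  have *: "z = p \<or> Im (v / (z - p)) = 0 \<longleftrightarrow> z \<in> affine hull {p, p + v}" for z
  proof
    assume "z = p \<or> Im (v / (z - p)) = 0"
    then obtain t :: real where "z - p = t *\<^sub>R v"
    proof
      assume "z = p" then show ?thesis using that[of 0] by simp
    next
      assume "Im (v / (z - p)) = 0"
      then have "Im ((z - p) / v) = 0"
        by (metis Im_i_times complex_is_Real_iff Reals_inverse inverse_divide)
      then have "(z - p) / v = of_real (Re ((z - p) / v))" by (simp add: complex_eq_iff)
      then have "z - p = Re ((z - p) / v) *\<^sub>R v"
        using assms by (simp add: scaleR_conv_of_real field_simps)
      then show ?thesis using that by blast
    qed
    then show "z \<in> affine hull {p, p + v}"
      by (auto simp: affine_hull_2_alt algebra_simps)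
  next
    assume "z \<in> affine hull {p, p + v}"
    then obtain t :: real where "z = p + t *\<^sub>R v" by (auto simp: affine_hull_2_alt)
    then show "z = p \<or> Im (v / (z - p)) = 0"
      using assms by (cases "t = 0") (simp_all add: scaleR_conv_of_real field_simps Im_divide_of_real)
  qed
  show ?thesis
  proof (intro set_eqI)
    fix X show "X \<in> tangent_circle p v 0 \<longleftrightarrow> X \<in> extended_line p (p + v)"
      using * by (cases X) (auto simp: extended_line_def Some_in_tangent_circle None_in_tangent_circle)
  qed
qed

lemma generalized_circle_tangent_circle:
  assumes "norm v = 1"
  shows "generalized_circle (tangent_circle p v k)"
proof (cases "k = 0")
  case True
  have "v \<noteq> 0" using assms by auto
  with True show ?thesis
    unfolding generalized_circle_def
    by (intro disjI2 exI[of _ p] exI[of _ "p + v"]) (simp add: tangent_circle_eq_extended_line)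
next
  case False
  then have "1 / (2 * \<bar>k\<bar>) > 0" by simp
  then show ?thesis
    unfolding generalized_circle_def tangent_circle_eq_round_circle[OF assms False]
    by blast
qed

lemma unit_tangent_at_tangent_circle:
  assumes "norm v = 1"
  shows "unit_tangent_at (tangent_circle p v k) p v"
proof (cases "k = 0")
  case True
  have "v \<noteq> 0" using assms by auto
  then have "tangent_circle p v k = extended_line p (p + v)" "p \<noteq> p + v" "v = 1 *\<^sub>R (p + v - p)"
    using True tangent_circle_eq_extended_line by simp_all
  then show ?thesis
    using assms Some_in_tangent_circle[of p p v k] unfolding unit_tangent_at_def by blast
next
  case False
  let ?m = "p - \<i> * v / of_real (2 * k)" and ?r = "1 / (2 * \<bar>k\<bar>)"
  have "(p - ?m) \<bullet> v = 0"
    by (simp add: inner_complex_def Re_divide_of_real Im_divide_of_real field_simps del: of_real_mult)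
  moreover have "?r > 0" using False by simp
  ultimately show ?thesis
    using assms tangent_circle_eq_round_circle[OF assms False, of p] Some_in_tangent_circle[of p p v k]
    unfolding unit_tangent_at_def by blast
qed

text \<open>
  Every generalized circle through $p$ has this form, which reduces uniqueness of the curvature
  circle to uniqueness of a line.
\<close>
lemma generalized_circle_through:
  assumes "generalized_circle K" "Some p \<in> K"
  obtains v k where "norm v = 1" "K = tangent_circle p v k"
  using assms(1) unfolding generalized_circle_def
proof (elim disjE exE conjE)
  fix m r assume r: "r > (0::real)" and K: "K = round_circle m r"
  have n: "norm (p - m) = r"
    using assms(2) K by (auto simp: round_circle_def dist_norm norm_minus_commute)
  \<comment> \<open>The tangent is a quarter turn of the radius at \<open>p\<close>; this orientation makes \<open>k\<close> negative.\<close>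
  let ?v = "\<i> * (p - m) / of_real r" and ?k = "- 1 / (2 * r)"
  have v: "norm ?v = 1" using n r by (simp add: norm_divide norm_mult)
  have "p - \<i> * ?v / of_real (2 * ?k) = m" "1 / (2 * \<bar>?k\<bar>) = r"
    using r by (simp_all add: field_simps)
  then have "tangent_circle p ?v ?k = K"
    using tangent_circle_eq_round_circle[OF v, of ?k p] r K by simp
  with v show ?thesis using that by metis
next
  fix x y assume xy: "x \<noteq> y" and K: "K = extended_line x y"
  define v where "v = sgn (y - x)"
  have v: "norm v = 1" using xy by (simp add: v_def norm_sgn)
  obtain t where t: "p = x + t *\<^sub>R (y - x)"
    using assms(2) K by (auto simp: extended_line_def affine_hull_2_alt)
  have yx: "y - x = norm (y - x) *\<^sub>R v" using xy by (simp add: v_def sgn_div_norm)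
  have "affine hull {x, y} = affine hull {p, p + v}"
  proof (intro equalityI subsetI)
    fix z assume "z \<in> affine hull {x, y}"
    then obtain w where "z = x + w *\<^sub>R (y - x)" by (auto simp: affine_hull_2_alt)
    then have "z = p + ((w - t) * norm (y - x)) *\<^sub>R v"
      using t yx by (metis (no_types, lifting) add_diff_eq add_diff_cancel_left' diff_add_eq scaleR_left_diff_distrib scaleR_scaleR add.commute)
    then show "z \<in> affine hull {p, p + v}" by (auto simp: affine_hull_2_alt)
  next
    fix z assume "z \<in> affine hull {p, p + v}"
    then obtain w where "z = p + w *\<^sub>R v" by (auto simp: affine_hull_2_alt)
    then have "z = x + (t + w / norm (y - x)) *\<^sub>R (y - x)"
      using t xy by (simp add: v_def sgn_div_norm scaleR_left_distrib divide_inverse)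
    then show "z \<in> affine hull {x, y}" unfolding affine_hull_2_alt by blast
  qed
  then have "K = tangent_circle p v 0"
    using v K by (subst tangent_circle_eq_extended_line) (auto simp: extended_line_def)
  with v show ?thesis using that by blast
qed

text \<open>
  Two lines that share two points coincide: both $v$ and $v'$ turn the difference of the points into
  a real number, so they agree up to sign, and a sign change of $v$ and $k$ gives the same circle.
\<close>
lemma tangent_circle_unique:
  assumes "norm v = 1" "norm v' = 1" "\<zeta>1 \<noteq> \<zeta>2"
    and "Im (v * \<zeta>1) = k" "Im (v * \<zeta>2) = k" "Im (v' * \<zeta>1) = k'" "Im (v' * \<zeta>2) = k'"
  shows "tangent_circle p v' k' = tangent_circle p v k"
proof -
  define x where "x = \<zeta>1 - \<zeta>2"
  have x: "x \<noteq> 0" using assms(3) by (simp add: x_def)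
  have "Im (v * x) = 0" "Im (v' * x) = 0"
    using assms(4-7) by (simp_all add: x_def algebra_simps)
  then obtain r r' where r: "v * x = of_real r" "v' * x = of_real r'"
    by (metis complex_is_Real_iff Reals_cases)
  then have "\<bar>r\<bar> = norm x" "\<bar>r'\<bar> = norm x"
    using assms(1,2) by (metis norm_mult norm_of_real mult_1)+
  then have "r' = r \<or> r' = - r" by linarith
  then have "v' * x = v * x \<or> v' * x = (- v) * x" using r by auto
  then have "v' = v \<or> v' = - v" using x by (metis mult_right_cancel)
  then show ?thesis
  proof
    assume "v' = v" then show ?thesis using assms(4,6) by simp
  next
    assume "v' = - v"
    then show ?thesis using assms(4,6) tangent_circle_uminus[of p v k] by simp
  qed
qed

section \<open>Edge points under affine maps and inversions\<close>

lemma edge_point_affine: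
  assumes "\<kappa> \<noteq> 0"
  shows "edge_point (z + \<kappa> * a) (z + \<kappa> * b) (z + \<kappa> * c) (z + \<kappa> * d) =
    map_option (\<lambda>t. z + \<kappa> * t) (edge_point a b c d)"
proof -
  have diff: "z + \<kappa> * x - (z + \<kappa> * y) = \<kappa> * (x - y)" for x y by (simp add: algebra_simps)
  have cr: "cr (z + \<kappa> * c) (z + \<kappa> * a) (z + \<kappa> * b) (z + \<kappa> * d) = cr c a b d"
    unfolding cr_def diff using assms by simp
  define w where "w = csqrt (cr c a b d)"
  define num where "num = c * (b - a) * w + b * (c - a)"
  define den where "den = (b - a) * w + (c - a)"
  have num': "(z + \<kappa> * c) * (\<kappa> * (b - a)) * w + (z + \<kappa> * b) * (\<kappa> * (c - a)) = \<kappa> * (z * den + \<kappa> * num)"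
    and den': "\<kappa> * (b - a) * w + \<kappa> * (c - a) = \<kappa> * den"
    by (simp_all add: num_def den_def algebra_simps)
  have "\<kappa> * (z * den + \<kappa> * num) / (\<kappa> * den) = z + \<kappa> * (num / den)" if "den \<noteq> 0"
    using assms that by (simp add: add_divide_distrib)
  then show ?thesis
    unfolding edge_point_def cr Let_def diff w_def[symmetric] num' den'
    unfolding num_def[symmetric] den_def[symmetric] using assms by simp
qed

text \<open>
  The cross ratio, hence the square root, does not change, and $f(a,b,c,d)$ is the image of this root
  under the Moebius map that sends $-1, 0, \infty$ to $a, b, c$. Numerator and denominator exchange
  roles up to a translation, which is also why the cases at infinity match.
\<close>
lemma edge_point_inversion:
  assumes "distinct [a, b, c, d]" "p \<notin> {a, b, c, d}"
  shows "edge_point (1 / (a - p)) (1 / (b - p)) (1 / (c - p)) (1 / (d - p)) =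
    inversion p (edge_point a b c d)"
proof -
  have nz: "a - p \<noteq> 0" "b - p \<noteq> 0" "c - p \<noteq> 0" "d - p \<noteq> 0" using assms(2) by auto
  have diff: "1 / x - 1 / y = (y - x) / (x * y)" if "x \<noteq> 0" "y \<noteq> 0" for x y :: complex
    using that by (simp add: field_simps)
  have "cr (1 / (c - p)) (1 / (a - p)) (1 / (b - p)) (1 / (d - p)) =
      ((a - c) / ((c - p) * (a - p)) * ((d - b) / ((b - p) * (d - p)))) /
      ((b - a) / ((a - p) * (b - p)) * ((c - d) / ((d - p) * (c - p))))"
    unfolding cr_def using nz by (simp add: diff)
  also have "\<dots> = ((a - c) * (d - b)) / ((b - a) * (c - d))"
    using nz by (simp add: divide_simps)
  also have "\<dots> = cr c a b d"
    unfolding cr_def by (simp add: algebra_simps)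
  finally have cr: "cr (1 / (c - p)) (1 / (a - p)) (1 / (b - p)) (1 / (d - p)) = cr c a b d" .
  define w where "w = csqrt (cr c a b d)"
  define num where "num = c * (b - a) * w + b * (c - a)"
  define den where "den = (b - a) * w + (c - a)"
  let ?n = "(a - p) * (b - p) * (c - p)"
  have num': "1 / (c - p) * (1 / (b - p) - 1 / (a - p)) * w + 1 / (b - p) * (1 / (c - p) - 1 / (a - p))
     = - den / ?n" (is "?num = _")
    using nz by (simp add: diff den_def divide_simps) (simp add: algebra_simps)
  have den': "(1 / (b - p) - 1 / (a - p)) * w + (1 / (c - p) - 1 / (a - p)) = - (num - p * den) / ?n"
    (is "?den = _")
    using nz by (simp add: diff den_def num_def divide_simps) (simp add: algebra_simps)
  \<comment> \<open>Numerator and denominator never vanish together, since the underlying Moebius map is invertible.\<close>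
  have "num - c * den = (b - c) * (c - a)" by (simp add: num_def den_def algebra_simps)
  then have nd: "num \<noteq> 0 \<or> den \<noteq> 0" using assms(1) by auto
  have "edge_point (1 / (a - p)) (1 / (b - p)) (1 / (c - p)) (1 / (d - p)) =
     (if ?den = 0 then None else Some (?num / ?den))"
    unfolding edge_point_def cr Let_def w_def ..
  also have "\<dots> = (if num - p * den = 0 then None else Some (den / (num - p * den)))"
  proof -
    have cancel: "- x / n / (- y / n) = x / y" "- y / n = 0 \<longleftrightarrow> y = 0" if "n \<noteq> 0" for x y n :: complex
      using that by simp_all
    have "?n \<noteq> 0" using nz by simp
    note cancel[OF this]
    then show ?thesis unfolding num' den' by (simp only:)
  qed
  also have "\<dots> = inversion p (if den = 0 then None else Some (num / den))"
    using nd by (auto simp: inversion_def field_simps)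
  also have "\<dots> = inversion p (edge_point a b c d)"
    by (simp add: edge_point_def w_def num_def den_def Let_def)
  finally show ?thesis .
qed

text \<open>
  In the coordinate in which $a, b, c$ are $-1, 0, \infty$, the point $d$ is $-w^2$, where $w$ is the
  root of the cross ratio, and the edge point is $w$. Equality with $c$ would force
  $w = \infty$, the other equalities $w = 0$ or $w = -1$; the value $-1$ is excluded because a
  principal root has nonnegative real part.
\<close>
lemma edge_point_neq:
  assumes "distinct [a, b, c, d]" "edge_point a b c d = Some p"
  shows "p \<notin> {a, b, c, d}"
proof -
  define w where "w = csqrt (cr c a b d)"
  define den where "den = (b - a) * w + (c - a)"
  have den: "den \<noteq> 0" and p: "p = (c * (b - a) * w + b * (c - a)) / den"
    using assms(2) by (auto simp: edge_point_def w_def den_def Let_def split: if_splits)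
  have ne: "a \<noteq> b" "a \<noteq> c" "a \<noteq> d" "b \<noteq> c" "b \<noteq> d" "c \<noteq> d" using assms(1) by auto
  have w2: "w\<^sup>2 = cr c a b d" by (simp add: w_def)
  have w0: "w \<noteq> 0" using ne by (auto simp: w_def cr_def)
  have "Re w \<ge> 0" unfolding w_def by (rule Re_csqrt)
  then have w1: "w + 1 \<noteq> 0" by (auto simp: complex_eq_iff)
  have pden: "p * den = c * (b - a) * w + b * (c - a)" using den p by simp
  have "(p - a) * den = (b - a) * (c - a) * (w + 1)"
    using pden by (simp add: left_diff_distrib) (simp add: den_def algebra_simps)
  moreover have "(p - b) * den = (c - b) * (b - a) * w"
    using pden by (simp add: left_diff_distrib) (simp add: den_def algebra_simps)
  moreover have "(p - c) * den = (b - c) * (c - a)"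
    using pden by (simp add: left_diff_distrib) (simp add: den_def algebra_simps)
  moreover have "p \<noteq> d"
  proof
    assume "p = d"
    then have e: "(c - a) * (d - b) = w * ((b - a) * (c - d))"
      using pden by (simp add: den_def algebra_simps)
    have "w\<^sup>2 * ((b - a) * (c - d)) = - ((c - a) * (d - b))"
      unfolding w2 cr_def using ne by (simp add: divide_simps) (simp add: algebra_simps)
    then have "w * (w + 1) * ((b - a) * (c - d)) = 0"
      unfolding e by (simp add: power2_eq_square algebra_simps)
    then show False using w0 w1 ne by auto
  qed
  ultimately show ?thesis using ne w0 w1 den by auto
qed

text \<open>
  The involution exchanging $a \leftrightarrow d$ and $b \leftrightarrow c$ fixes infinity and is
  therefore a point reflection. The same square root occurs for $(c,d,a,b)$, where it selects the other
  fixed point, the centre.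
\<close>
lemma parallelogram_of_edge_point_None:
  assumes "distinct [a, b, c, d]" "edge_point a b c d = None"
  shows "a + d = b + c" "edge_point c d a b = Some ((a + d) / 2)"
proof -
  have ne: "a \<noteq> b" "a \<noteq> c" "a \<noteq> d" "b \<noteq> c" "b \<noteq> d" "c \<noteq> d" using assms(1) by auto
  define w where "w = csqrt (cr c a b d)"
  have w2: "w\<^sup>2 = cr c a b d" by (simp add: w_def)
  have den: "(b - a) * w + (c - a) = 0"
    using assms(2) by (auto simp: edge_point_def w_def Let_def split: if_splits)
  then have w: "(b - a) * w = a - c" by (simp add: algebra_simps)
  have "w\<^sup>2 * ((a - b) * (d - c)) = (c - a) * (b - d)"
    unfolding w2 cr_def using ne by (simp add: divide_simps)
  moreover have "((b - a) * w)\<^sup>2 * (d - c) = w\<^sup>2 * ((a - b) * (d - c)) * (a - b)"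
    by (simp add: power2_eq_square algebra_simps)
  ultimately have "((b - a) * w)\<^sup>2 * (d - c) = (c - a) * (b - d) * (a - b)" by simp
  then have "(c - a) * (b - c) * (a + d - b - c) = 0"
    unfolding w by (simp add: power2_eq_square algebra_simps)
  then have "a + d - b - c = 0" using ne by simp
  then show ad: "a + d = b + c" by (simp add: algebra_simps)
  have "cr a c d b = cr c a b d" unfolding cr_def by (simp add: algebra_simps)
  then have w': "csqrt (cr a c d b) = w" by (simp add: w_def)
  have dc: "d - c = b - a" using ad by (simp add: algebra_simps)
  have d1: "(d - c) * w + (a - c) = 2 * (a - c)" unfolding dc w by simp
  have "a * (d - c) * w + d * (a - c) = (a + d) * (a - c)"
    unfolding dc mult.assoc w by (simp add: algebra_simps)
  then show "edge_point c d a b = Some ((a + d) / 2)"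
  proof -
    assume num: "a * (d - c) * w + d * (a - c) = (a + d) * (a - c)"
    have "x * y / (2 * y) = x / 2" "2 * y \<noteq> 0" if "y \<noteq> 0" for x y :: complex
      using that by simp_all
    note cancel = this
    have "a - c \<noteq> 0" using ne by simp
    note * = cancel[OF this]
    then show ?thesis unfolding edge_point_def Let_def w' d1 num using * by (simp only: if_False)
  qed
qed

text \<open>
  Put the centre of the parallelogram at $0$, so that $a = x$, $b = y$, $c = -y$, $d = -x$. The
  involution exchanging $a \leftrightarrow b$ and $c \leftrightarrow d$ is $z \mapsto xy/z$, with
  fixed points $\pm e$ where $e^2 = xy$. The two edge points use the same square root and are the two
  different fixed points, whichever root is principal.
\<close>
lemma edge_points_of_parallelogram:
  assumes "distinct [a, b, c, d]" "a + d = b + c"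
  obtains e where "edge_point b c d a = Some ((a + d) / 2 + e)"
    "edge_point d a b c = Some ((a + d) / 2 - e)" "4 * e\<^sup>2 = (a - d) * (b - c)"
proof -
  define m where "m = (a + d) / 2"
  define x where "x = (a - d) / 2"
  define y where "y = (b - c) / 2"
  have m': "m = (b + c) / 2" using assms(2) by (simp add: m_def)
  have abcd: "a = m + x" "d = m - x" "b = m + y" "c = m - y"
  proof -
    show "a = m + x" "d = m - x" unfolding m_def x_def by (simp_all add: field_simps)
    show "b = m + y" "c = m - y" unfolding m' y_def by (simp_all add: field_simps)
  qed
  have ne: "x \<noteq> 0" "y \<noteq> 0" "x \<noteq> y" "x + y \<noteq> 0"
    using assms(1) by (auto simp: abcd add_eq_0_iff2 add_eq_0_iff)
  define w where "w = csqrt (cr d b c a)"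
  have crs: "cr b d a c = cr d b c a" unfolding cr_def by (simp add: algebra_simps)
  have "w\<^sup>2 = cr d b c a" by (simp add: w_def)
  also have "\<dots> = (x + y)\<^sup>2 / (4 * x * y)"
    using ne by (simp add: cr_def abcd power2_eq_square field_simps)
  finally have w2: "4 * x * y * w\<^sup>2 = (x + y)\<^sup>2" using ne by simp
  \<comment> \<open>Up to sign, these are the denominators of the two edge points.\<close>
  define f where "f = 2 * y * w + (x + y)"
  define g where "g = 2 * x * w + (x + y)"
  have f: "x * f\<^sup>2 = (x + y) * ((x + y)\<^sup>2 + 4 * x * y * w)"
  proof -
    have "x * f\<^sup>2 = y * (4 * x * y * w\<^sup>2) + x * (x + y)\<^sup>2 + 4 * x * y * w * (x + y)"
      by (simp add: f_def power2_eq_square algebra_simps)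
    then show ?thesis unfolding w2 by (simp add: power2_eq_square algebra_simps)
  qed
  have g: "y * g\<^sup>2 = (x + y) * ((x + y)\<^sup>2 + 4 * x * y * w)"
  proof -
    have "y * g\<^sup>2 = x * (4 * x * y * w\<^sup>2) + y * (x + y)\<^sup>2 + 4 * x * y * w * (x + y)"
      by (simp add: g_def power2_eq_square algebra_simps)
    then show ?thesis unfolding w2 by (simp add: power2_eq_square algebra_simps)
  qed
  have fg: "x * f\<^sup>2 = y * g\<^sup>2" using f g by simp
  have f0: "f \<noteq> 0"
  proof
    assume "f = 0"
    then have "g = 0" using fg ne by simp
    have "f - g = 2 * (y - x) * w" by (simp add: f_def g_def algebra_simps)
    then have "w = 0" using \<open>f = 0\<close> \<open>g = 0\<close> ne by simp
    then show False using w2 ne by simp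
  qed
  then have g0: "g \<noteq> 0" using fg ne by auto
  define e where "e = - y * g / f"
  have e': "e = - x * f / g" using fg f0 g0 by (simp add: e_def field_simps power2_eq_square)
  have den1: "(c - b) * w + (d - b) = - f" by (simp add: abcd f_def algebra_simps)
  have "d * (c - b) * w + c * (d - b) = - (m * f) + y * g"
    by (simp add: abcd f_def g_def algebra_simps)
  then have e1: "edge_point b c d a = Some (m + e)"
  proof -
    assume num: "d * (c - b) * w + c * (d - b) = - (m * f) + y * g"
    have "(- (m * f) + y * g) / - f = m + e" "- f \<noteq> 0" using f0 by (simp_all add: e_def field_simps)
    then show ?thesis
      unfolding edge_point_def w_def[symmetric] Let_def den1 num by (simp only: if_False)
  qed
  have den2: "(a - d) * w + (b - d) = g" by (simp add: abcd g_def algebra_simps)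
  have "b * (a - d) * w + a * (b - d) = m * g + x * f"
    by (simp add: abcd f_def g_def algebra_simps)
  then have e2: "edge_point d a b c = Some (m - e)"
  proof -
    assume num: "b * (a - d) * w + a * (b - d) = m * g + x * f"
    have "(m * g + x * f) / g = m - e" using g0 by (simp add: e' field_simps)
    with g0 show ?thesis
      unfolding edge_point_def crs w_def[symmetric] Let_def den2 num by (simp only: if_False)
  qed
  have "e\<^sup>2 = (- y * g / f) * (- x * f / g)" unfolding power2_eq_square using e' e_def by simp
  also have "\<dots> = x * y" using f0 g0 by simp
  finally have "4 * e\<^sup>2 = (a - d) * (b - c)" by (simp add: abcd)
  then show ?thesis using that e1 e2 by (simp add: m_def)
qed

lemma in_tangent_circle_if_inversion:
  "inversion p X = Some \<zeta> \<Longrightarrow> X \<in> tangent_circle p v k \<longleftrightarrow> Im (v * \<zeta>) = k"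
  by (simp add: tangent_circle_def)

text \<open>
  The condition determines $v$ up to sign: $(ve)^2$ is positive for the half distance $e$ between two
  inverted edge points, so $ve$ is real and $v$ is the direction of the line through them.
\<close>
lemma unit_tangent_at_curvature_circle:
  assumes dist: "distinct [a, b, c, d]" and p: "edge_point a b c d = Some p"
    and v: "norm v = 1" and "r > 0"
    and vr: "v\<^sup>2 * ((1 / (a - p) - 1 / (d - p)) * (1 / (b - p) - 1 / (c - p))) = of_real r"
  shows "unit_tangent_at (curvature_circle a b c d) p v"
proof -
  have np: "p \<notin> {a, b, c, d}" using edge_point_neq[OF dist p] .
  define \<alpha> \<beta> \<delta> \<eta> where defs: "\<alpha> = 1 / (a - p)" "\<beta> = 1 / (b - p)" "\<delta> = 1 / (c - p)" "\<eta> = 1 / (d - p)"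
  have dist': "distinct [\<alpha>, \<beta>, \<delta>, \<eta>]" using dist np by (auto simp: defs)
  have "edge_point \<alpha> \<beta> \<delta> \<eta> = None"
    using edge_point_inversion[OF dist np] p by (simp add: defs inversion_def)
  note par = parallelogram_of_edge_point_None[OF dist' this]
  define m where "m = (\<alpha> + \<eta>) / 2"
  obtain e where e: "edge_point \<beta> \<delta> \<eta> \<alpha> = Some (m + e)" "edge_point \<eta> \<alpha> \<beta> \<delta> = Some (m - e)"
    "4 * e\<^sup>2 = (\<alpha> - \<eta>) * (\<beta> - \<delta>)"
    using edge_points_of_parallelogram[OF dist' par(1)] by (metis m_def)
  have i1: "inversion p (edge_point b c d a) = Some (m + e)"
    using edge_point_inversion[of b c d a p] dist np e(1) by (auto simp: defs)
  have i2: "inversion p (edge_point d a b c) = Some (m - e)"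
    using edge_point_inversion[of d a b c p] dist np e(2) by (auto simp: defs)
  have i3: "inversion p (edge_point c d a b) = Some m"
    using edge_point_inversion[of c d a b p] dist np par(2) by (auto simp: defs m_def)
  have "(v * e)\<^sup>2 = v\<^sup>2 * (4 * e\<^sup>2) / 4" by (simp add: power_mult_distrib)
  also have "\<dots> = of_real (r / 4)" using vr unfolding e(3) by (simp add: defs)
  finally have "(v * e)\<^sup>2 = of_real (r / 4)" .
  then have "Im (v * e) = 0"
  proof -
    assume h: "(v * e)\<^sup>2 = of_real (r / 4)"
    then have "(v * e)\<^sup>2 = (of_real (sqrt (r / 4)))\<^sup>2"
      using \<open>r > 0\<close> by (simp flip: of_real_power)
    then have "v * e = of_real (sqrt (r / 4)) \<or> v * e = - of_real (sqrt (r / 4))"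
      by (simp only: power2_eq_iff)
    then show ?thesis
      by (elim disjE) (simp_all only: uminus_complex.simps Im_complex_of_real minus_zero)
  qed
  define k where "k = Im (v * m)"
  have k: "Im (v * m) = k" "Im (v * (m + e)) = k" "Im (v * (m - e)) = k"
    using \<open>Im (v * e) = 0\<close> by (simp_all add: k_def algebra_simps)
  have "\<alpha> \<noteq> \<eta>" "\<beta> \<noteq> \<delta>" using dist' by auto
  then have "e \<noteq> 0" using e(3) by auto
  have "curvature_circle a b c d = tangent_circle p v k"
    unfolding curvature_circle_def
  proof (rule the_equality)
    show "generalized_circle (tangent_circle p v k) \<and>
      {edge_point d a b c, edge_point a b c d, edge_point b c d a, edge_point c d a b}
        \<subseteq> tangent_circle p v k"
      using generalized_circle_tangent_circle[OF v] i1 i2 i3 k p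
      by (simp add: in_tangent_circle_if_inversion Some_in_tangent_circle)
  next
    fix K assume K: "generalized_circle K \<and>
      {edge_point d a b c, edge_point a b c d, edge_point b c d a, edge_point c d a b} \<subseteq> K"
    then obtain v' k' where v': "norm v' = 1" "K = tangent_circle p v' k'"
      using generalized_circle_through[of K p] p by auto
    have "Im (v' * (m + e)) = k'" "Im (v' * (m - e)) = k'"
      using K v' i1 i2 by (auto simp: in_tangent_circle_if_inversion)
    moreover have "m + e \<noteq> m - e" using \<open>e \<noteq> 0\<close> by (simp add: eq_neg_iff_add_eq_0)
    ultimately show "K = tangent_circle p v k"
      using tangent_circle_unique[OF v v'(1)] k v'(2) by metis
  qed
  then show ?thesis using unit_tangent_at_tangent_circle[OF v] by simp
qed

section \<open>Taylor estimates for curves\<close>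

text \<open>
  One step of integrating a Taylor remainder.
\<close>
lemma norm_le_power_Suc_if_vector_derivative:
  fixes g :: "real \<Rightarrow> 'a :: real_normed_vector"
  assumes "g 0 = 0" "C \<ge> 0"
    and deriv: "\<And>y. \<bar>y\<bar> < \<delta> \<Longrightarrow> (g has_vector_derivative g' y) (at y)"
    and bound: "\<And>y. \<bar>y\<bar> < \<delta> \<Longrightarrow> norm (g' y) \<le> C * \<bar>y\<bar> ^ n"
    and x: "\<bar>x\<bar> < \<delta>"
  shows "norm (g x) \<le> C * \<bar>x\<bar> ^ Suc n"
proof -
  have "norm (g x - g 0) \<le> C * \<bar>x\<bar> ^ n * norm (x - 0)"
  proof (rule differentiable_bound)
    fix y assume "y \<in> {-\<bar>x\<bar>..\<bar>x\<bar>}"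
    then have y: "\<bar>y\<bar> \<le> \<bar>x\<bar>" by auto
    then show "(g has_derivative (\<lambda>h. h *\<^sub>R g' y)) (at y within {-\<bar>x\<bar>..\<bar>x\<bar>})"
      using deriv[of y] x has_derivative_at_withinI by (auto simp: has_vector_derivative_def)
    have "onorm (\<lambda>h::real. h *\<^sub>R g' y) \<le> norm (g' y)"
      by (rule onorm_bound) (auto simp: mult.commute)
    also have "\<dots> \<le> C * \<bar>y\<bar> ^ n" using bound y x by simp
    also have "\<dots> \<le> C * \<bar>x\<bar> ^ n" using y assms(2) by (intro mult_left_mono power_mono) auto
    finally show "onorm (\<lambda>h. h *\<^sub>R g' y) \<le> C * \<bar>x\<bar> ^ n" .
  qed auto
  with assms(1) show ?thesis by (simp add: mult_ac)
qed

lemma differentiable_imp_linear_bound: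
  fixes f :: "real \<Rightarrow> 'a :: real_normed_vector"
  assumes "f differentiable at u"
  obtains C \<delta> where "C \<ge> 0" "\<delta> > 0" "\<And>x. \<bar>x\<bar> < \<delta> \<Longrightarrow> norm (f (u + x) - f u) \<le> C * \<bar>x\<bar>"
proof -
  define D where "D = vector_derivative f (at u)"
  have "(f has_derivative (\<lambda>h. h *\<^sub>R D)) (at u)"
    using assms unfolding D_def by (simp add: vector_derivative_works has_vector_derivative_def)
  then obtain \<delta> where \<delta>: "\<delta> > 0"
    "\<And>y. norm (y - u) < \<delta> \<Longrightarrow> norm (f y - f u - (y - u) *\<^sub>R D) \<le> 1 * norm (y - u)"
    unfolding has_derivative_at_alt by (meson zero_less_one)
  have "norm (f (u + x) - f u) \<le> (1 + norm D) * \<bar>x\<bar>" if "\<bar>x\<bar> < \<delta>" for x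
  proof -
    have "norm (f (u + x) - f u) \<le> norm (f (u + x) - f u - x *\<^sub>R D) + norm (x *\<^sub>R D)"
      using norm_triangle_sub[of "f (u + x) - f u" "x *\<^sub>R D"] by linarith
    also have "\<dots> \<le> \<bar>x\<bar> + \<bar>x\<bar> * norm D" using \<delta>(2)[of "u + x"] that by simp
    finally show ?thesis by (simp add: algebra_simps)
  qed
  with \<delta>(1) show ?thesis using that[of "1 + norm D" \<delta>] by simp
qed

lemma bigo_power_at_0I:
  fixes f :: "real \<Rightarrow> complex"
  assumes "\<delta> > 0" "\<And>x. \<bar>x\<bar> < \<delta> \<Longrightarrow> norm (f x) \<le> C * \<bar>x\<bar> ^ n"
  shows "f \<in> O[at 0](\<lambda>x. of_real x ^ n)"
proof (rule bigoI)
  show "\<forall>\<^sub>F x in at 0. norm (f x) \<le> C * norm (complex_of_real x ^ n)"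
    unfolding eventually_at using assms by (auto simp: norm_power intro!: exI[of _ \<delta>])
qed

lemma class_C_has_vector_derivative:
  assumes "class_C k s" "j < k"
  shows "(iter_vderiv j s has_vector_derivative iter_vderiv (Suc j) s t) (at t)"
  using assms by (auto simp: class_C_def iter_vderiv_def simp flip: vector_derivative_works)

lemma class_C_3_derivatives:
  assumes C3: "class_C 3 s"
  obtains s2 s3 where
    "\<And>t. (s has_vector_derivative vector_derivative s (at t)) (at t)"
    "\<And>t. ((\<lambda>t. vector_derivative s (at t)) has_vector_derivative s2 t) (at t)"
    "\<And>t. (s2 has_vector_derivative s3 t) (at t)"
proof -
  have "iter_vderiv 0 s = s" "iter_vderiv 1 s = (\<lambda>t. vector_derivative s (at t))"
    by (simp_all add: iter_vderiv_def)
  then show ?thesis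
    using class_C_has_vector_derivative[OF C3, of 0] class_C_has_vector_derivative[OF C3, of 1]
      class_C_has_vector_derivative[OF C3, of 2] that[of "iter_vderiv 2 s" "iter_vderiv 3 s"]
    by (simp add: numeral_2_eq_2 numeral_3_eq_3)
qed

lemma class_C_3_first_order:
  assumes C3: "class_C 3 s"
  shows "(\<lambda>x. s (u + x) - s u - of_real x * vector_derivative s (at u)) \<in> O[at 0](\<lambda>x. of_real x ^ 2)"
proof -
  define s1 where "s1 t = vector_derivative s (at t)" for t
  obtain s2 s3 where d: "\<And>t. (s has_vector_derivative s1 t) (at t)"
    "\<And>t. (s1 has_vector_derivative s2 t) (at t)" "\<And>t. (s2 has_vector_derivative s3 t) (at t)"
    using class_C_3_derivatives[OF C3] unfolding s1_def by blast
  obtain C \<delta> where C: "C \<ge> 0" "\<delta> > 0" "\<And>x. \<bar>x\<bar> < \<delta> \<Longrightarrow> norm (s1 (u + x) - s1 u) \<le> C * \<bar>x\<bar>"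
    using differentiable_imp_linear_bound d(2) differentiableI_vector by metis
  have ds: "((\<lambda>x. s (u + x)) has_vector_derivative s1 (u + x)) (at x)" for x
  proof -
    have "((\<lambda>x. u + x) has_vector_derivative 1) (at x)" by (auto intro!: derivative_eq_intros)
    from vector_diff_chain_at[OF this, of s "s1 (u + x)"] d(1)[of "u + x"] show ?thesis
      by (simp add: o_def)
  qed
  have "norm (s (u + x) - s u - x *\<^sub>R s1 u) \<le> C * \<bar>x\<bar> ^ Suc 1" if "\<bar>x\<bar> < \<delta>" for x
  proof (rule norm_le_power_Suc_if_vector_derivative[where \<delta> = \<delta> and g' = "\<lambda>x. s1 (u + x) - s1 u"])
    fix y show "((\<lambda>x. s (u + x) - s u - x *\<^sub>R s1 u) has_vector_derivative s1 (u + y) - s1 u) (at y)"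
      by (auto intro!: derivative_eq_intros ds)
  qed (use C that in auto)
  then show ?thesis
    using C(2) by (intro bigo_power_at_0I) (auto simp: s1_def scaleR_conv_of_real numeral_2_eq_2)
qed

text \<open>
  The second derivative of the left-hand side is $s''(u + x) - s''(u - x)$, which is $O(x)$ since $s''$
  is differentiable; integrating twice from $0$ raises the order to $3$.
\<close>
lemma class_C_3_symmetric_difference:
  assumes C3: "class_C 3 s"
  shows "(\<lambda>x. s (u + x) - s (u - x) - 2 * of_real x * vector_derivative s (at u))
     \<in> O[at 0](\<lambda>x. of_real x ^ 3)"
proof -
  define s1 where "s1 t = vector_derivative s (at t)" for t
  obtain s2 s3 where d: "\<And>t. (s has_vector_derivative s1 t) (at t)"
    "\<And>t. (s1 has_vector_derivative s2 t) (at t)" "\<And>t. (s2 has_vector_derivative s3 t) (at t)"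
    using class_C_3_derivatives[OF C3] unfolding s1_def by blast
  obtain C \<delta> where C: "C \<ge> 0" "\<delta> > 0" "\<And>x. \<bar>x\<bar> < \<delta> \<Longrightarrow> norm (s2 (u + x) - s2 u) \<le> C * \<bar>x\<bar>"
    using differentiable_imp_linear_bound d(3) differentiableI_vector by metis
  have shift: "((\<lambda>x. f (u + x)) has_vector_derivative f' (u + x)) (at x)"
    "((\<lambda>x. f (u - x)) has_vector_derivative - f' (u - x)) (at x)"
    if "\<And>t. (f has_vector_derivative f' t) (at t)" for f f' :: "real \<Rightarrow> complex" and x
  proof -
    have *: "((\<lambda>x. u + x) has_vector_derivative 1) (at x)" "((\<lambda>x. u - x) has_vector_derivative -1) (at x)"
      by (auto intro!: derivative_eq_intros)
    show "((\<lambda>x. f (u + x)) has_vector_derivative f' (u + x)) (at x)"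
      using vector_diff_chain_at[OF *(1), of f "f' (u + x)"] that by (simp add: o_def)
    show "((\<lambda>x. f (u - x)) has_vector_derivative - f' (u - x)) (at x)"
      using vector_diff_chain_at[OF *(2), of f "f' (u - x)"] that by (simp add: o_def)
  qed
  have b2: "norm (s2 (u + x) - s2 (u - x)) \<le> (2 * C) * \<bar>x\<bar> ^ 1" if "\<bar>x\<bar> < \<delta>" for x
    using norm_triangle_ineq4[of "s2 (u + x) - s2 u" "s2 (u - x) - s2 u"] C(3)[of x] C(3)[of "-x"] that
    by simp
  have b1: "norm (s1 (u + x) + s1 (u - x) - 2 * s1 u) \<le> (2 * C) * \<bar>x\<bar> ^ Suc 1" if "\<bar>x\<bar> < \<delta>" for x
  proof (rule norm_le_power_Suc_if_vector_derivative[where \<delta> = \<delta> and g' = "\<lambda>x. s2 (u + x) - s2 (u - x)"])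
    fix y show "((\<lambda>x. s1 (u + x) + s1 (u - x) - 2 * s1 u)
        has_vector_derivative s2 (u + y) - s2 (u - y)) (at y)"
      by (auto intro!: derivative_eq_intros shift d)
  qed (use C that b2 in auto)
  have "norm (s (u + x) - s (u - x) - x *\<^sub>R (2 * s1 u)) \<le> (2 * C) * \<bar>x\<bar> ^ Suc (Suc 1)" if "\<bar>x\<bar> < \<delta>" for x
  proof (rule norm_le_power_Suc_if_vector_derivative
      [where \<delta> = \<delta> and g' = "\<lambda>x. s1 (u + x) + s1 (u - x) - 2 * s1 u"])
    fix y show "((\<lambda>x. s (u + x) - s (u - x) - x *\<^sub>R (2 * s1 u))
        has_vector_derivative s1 (u + y) + s1 (u - y) - 2 * s1 u) (at y)"
      by (auto intro!: derivative_eq_intros shift d)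
  qed (use C that b1 in auto)
  then show ?thesis
    using C(2) by (intro bigo_power_at_0I[where C = "2 * C"])
      (auto simp: s1_def scaleR_conv_of_real power3_eq_cube mult_ac)
qed

section \<open>Expansions with an error term\<close>

text \<open>
  The following rules propagate statements $f = a + O(h)$ with $h \to 0$, written
  \<open>(\<lambda>x. f x - a) \<in> O[F](h)\<close>, through arithmetic operations.
\<close>
lemma tendsto_of_bigo_diff:
  fixes f h :: "'a \<Rightarrow> complex"
  assumes "(\<lambda>x. f x - a) \<in> O[F](h)" "(h \<longlongrightarrow> 0) F"
  shows "(f \<longlongrightarrow> a) F"
proof -
  have "h \<in> o[F](\<lambda>_. 1)" using assms(2) by (intro smalloI_tendsto) auto
  with assms(1) have "(\<lambda>x. f x - a) \<in> o[F](\<lambda>_. 1)" by (rule landau_o.big_small_trans)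
  then have "((\<lambda>x. f x - a) \<longlongrightarrow> 0) F" using smalloD_tendsto by fastforce
  then show ?thesis by (simp add: LIM_zero_iff)
qed

lemma bigo_diff_mult:
  fixes f g h :: "'a \<Rightarrow> complex"
  assumes f: "(\<lambda>x. f x - a) \<in> O[F](h)" and g: "(\<lambda>x. g x - b) \<in> O[F](h)" and h: "(h \<longlongrightarrow> 0) F"
  shows "(\<lambda>x. f x * g x - a * b) \<in> O[F](h)"
proof -
  have "f \<in> O[F](\<lambda>_. 1)"
    using tendsto_of_bigo_diff[OF f h] by (intro bigoI_tendsto[of _ _ a]) auto
  then have "(\<lambda>x. f x * (g x - b)) \<in> O[F](\<lambda>x. 1 * h x)" by (rule landau_o.big.mult) (rule g)
  moreover have "(\<lambda>x. b * (f x - a)) \<in> O[F](h)" using f by simp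
  ultimately have "(\<lambda>x. f x * (g x - b) + b * (f x - a)) \<in> O[F](h)" by (intro sum_in_bigo) simp_all
  then show ?thesis by (simp add: algebra_simps)
qed

lemma bigo_diff_inverse:
  fixes f h :: "'a \<Rightarrow> complex"
  assumes f: "(\<lambda>x. f x - a) \<in> O[F](h)" and h: "(h \<longlongrightarrow> 0) F" and "a \<noteq> 0"
  shows "(\<lambda>x. inverse (f x) - inverse a) \<in> O[F](h)"
proof -
  have lim: "(f \<longlongrightarrow> a) F" by (rule tendsto_of_bigo_diff[OF f h])
  have "((\<lambda>x. - inverse (f x) * inverse a) \<longlongrightarrow> - inverse a * inverse a) F"
    by (intro tendsto_intros lim \<open>a \<noteq> 0\<close>)
  then have "(\<lambda>x. - inverse (f x) * inverse a) \<in> O[F](\<lambda>_. 1)"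
    by (intro bigoI_tendsto) auto
  from landau_o.big.mult[OF this f]
  have "(\<lambda>x. - inverse (f x) * inverse a * (f x - a)) \<in> O[F](h)" by simp
  moreover have "\<forall>\<^sub>F x in F. - inverse (f x) * inverse a * (f x - a) = inverse (f x) - inverse a"
    using tendsto_imp_eventually_ne[OF lim \<open>a \<noteq> 0\<close>]
    by eventually_elim (use \<open>a \<noteq> 0\<close> in \<open>simp add: field_simps\<close>)
  ultimately show ?thesis by (simp only: landau_o.big.in_cong)
qed

lemma bigo_diff_divide:
  fixes f g h :: "'a \<Rightarrow> complex"
  assumes "(\<lambda>x. f x - a) \<in> O[F](h)" "(\<lambda>x. g x - b) \<in> O[F](h)" "(h \<longlongrightarrow> 0) F" "b \<noteq> 0"
  shows "(\<lambda>x. f x / g x - a / b) \<in> O[F](h)"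
  using bigo_diff_mult[OF assms(1) bigo_diff_inverse[OF assms(2-4)] assms(3)]
  by (simp add: divide_inverse)

lemma bigo_diff_add:
  fixes f g h :: "'a \<Rightarrow> complex"
  assumes "(\<lambda>x. f x - a) \<in> O[F](h)" "(\<lambda>x. g x - b) \<in> O[F](h)"
  shows "(\<lambda>x. (f x + g x) - (a + b)) \<in> O[F](h)"
  using sum_in_bigo(1)[OF assms] by (simp add: algebra_simps)

lemma bigo_diff_diff:
  fixes f g h :: "'a \<Rightarrow> complex"
  assumes "(\<lambda>x. f x - a) \<in> O[F](h)" "(\<lambda>x. g x - b) \<in> O[F](h)"
  shows "(\<lambda>x. (f x - g x) - (a - b)) \<in> O[F](h)"
  using sum_in_bigo(2)[OF assms] by (simp add: algebra_simps)

text \<open>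
  The closed right half plane contains the principal root $\sqrt z$, so $|\sqrt z + r| \ge r$ and
  $|\sqrt z - r| \le |z - r^2| / r$ for every $z$.
\<close>
lemma bigo_diff_csqrt:
  fixes f h :: "'a \<Rightarrow> complex"
  assumes f: "(\<lambda>x. f x - of_real (r\<^sup>2)) \<in> O[F](h)" and "r > 0"
  shows "(\<lambda>x. csqrt (f x) - of_real r) \<in> O[F](h)"
proof -
  have "norm (csqrt z - of_real r) \<le> (1 / r) * norm (z - of_real (r\<^sup>2))" for z
  proof -
    have "r \<le> Re (csqrt z + of_real r)" using Re_csqrt[of z] by simp
    also have "\<dots> \<le> norm (csqrt z + of_real r)" by (rule complex_Re_le_cmod)
    finally have "r * norm (csqrt z - of_real r) \<le> norm (csqrt z + of_real r) * norm (csqrt z - of_real r)"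
      by (intro mult_right_mono) auto
    also have "\<dots> = norm ((csqrt z)\<^sup>2 - of_real (r\<^sup>2))"
      by (simp only: norm_mult[symmetric]) (simp add: power2_eq_square algebra_simps)
    finally show ?thesis using \<open>r > 0\<close> by (simp add: field_simps)
  qed
  then have "(\<lambda>x. csqrt (f x) - of_real r) \<in> O[F](\<lambda>x. f x - of_real (r\<^sup>2))"
    by (intro bigoI[of _ "1 / r"] always_eventually) auto
  then show ?thesis using f by (rule landau_o.big_trans)
qed

lemma bigo_diff_sgn:
  fixes f h :: "'a \<Rightarrow> complex"
  assumes f: "(\<lambda>x. f x - of_real r) \<in> O[F](h)" and "r > 0"
  shows "(\<lambda>x. sgn (f x) - 1) \<in> O[F](h)"
proof -
  have "norm (sgn z - 1) \<le> (2 / r) * norm (z - of_real r)" for z :: complex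
  proof -
    have "of_real r * (sgn z - 1) = of_real (r - norm z) * sgn z + (z - of_real r)"
      by (cases "z = 0") (simp_all add: sgn_eq algebra_simps)
    then have "r * norm (sgn z - 1) \<le> norm (of_real (r - norm z) * sgn z) + norm (z - of_real r)"
      using \<open>r > 0\<close> norm_triangle_ineq by (metis abs_of_pos norm_mult norm_of_real)
    also have "norm (of_real (r - norm z) * sgn z) \<le> \<bar>r - norm z\<bar>"
      by (simp only: norm_mult norm_of_real norm_sgn) simp
    also have "\<bar>r - norm z\<bar> \<le> norm (z - of_real r)"
      using norm_triangle_ineq3[of "of_real r" z] \<open>r > 0\<close> by (simp add: norm_minus_commute)
    finally show ?thesis using \<open>r > 0\<close> by (simp add: field_simps)
  qed
  then have "(\<lambda>x. sgn (f x) - 1) \<in> O[F](\<lambda>x. f x - of_real r)"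
    by (intro bigoI[of _ "2 / r"] always_eventually) auto
  then show ?thesis using f by (rule landau_o.big_trans)
qed

section \<open>The curvature circle of a sampled curve\<close>

text \<open>
  This is where the second order comes from: although $A$, $D$ and $P$ are controlled only up to
  $O(h)$, the first-order errors of $A - P$ and $D - P$ agree up to $O(h^2)$ and cancel in the product
  $(A - P)(D - P) = (Y - n)(Y + n + Z) = -n^2 + Y^2 + (Y - n)Z$, where $Y = O(h)$ and
  $Z = O(h^2)$.
\<close>
lemma bigo_symmetric_pair:
  fixes A D P h :: "'a \<Rightarrow> complex"
  assumes h: "(h \<longlongrightarrow> 0) F" and "n \<noteq> 0"
    and A: "(\<lambda>x. A x - - n) \<in> O[F](h)" and P: "P \<in> O[F](h)"
    and AD: "(\<lambda>x. D x - A x - 2 * n) \<in> O[F](\<lambda>x. h x ^ 2)"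
  shows "(\<lambda>x. inverse (1 / (A x - P x) - 1 / (D x - P x)) - - (n / 2)) \<in> O[F](\<lambda>x. h x ^ 2)"
proof -
  have h2: "((\<lambda>x. h x ^ 2) \<longlongrightarrow> 0) F" using tendsto_power[OF h, of 2] by simp
  define Y where "Y x = A x - P x + n" for x
  define Z where "Z x = D x - A x - 2 * n" for x
  have P': "(\<lambda>x. P x - 0) \<in> O[F](h)" using P by simp
  have Y: "Y \<in> O[F](h)" using bigo_diff_diff[OF A P'] by (simp add: Y_def[abs_def])
  have Z: "Z \<in> O[F](\<lambda>x. h x ^ 2)" using AD by (simp add: Z_def[abs_def])
  have AP: "((\<lambda>x. A x - P x) \<longlongrightarrow> - n) F"
    using tendsto_of_bigo_diff[OF bigo_diff_diff[OF A P'] h] by simp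
  have DA: "((\<lambda>x. D x - A x) \<longlongrightarrow> 2 * n) F"
    by (rule tendsto_of_bigo_diff[OF AD h2])
  have DP: "((\<lambda>x. D x - P x) \<longlongrightarrow> n) F"
    using tendsto_add[OF AP DA] by simp
  have YY: "(\<lambda>x. Y x * Y x) \<in> O[F](\<lambda>x. h x ^ 2)"
    using landau_o.big.mult[OF Y Y] by (simp add: power2_eq_square)
  have "((\<lambda>x. Y x - n) \<longlongrightarrow> - n) F" using AP by (simp add: Y_def)
  then have "(\<lambda>x. Y x - n) \<in> O[F](\<lambda>_. 1)" by (intro bigoI_tendsto) auto
  from landau_o.big.mult[OF this Z]
  have "(\<lambda>x. (Y x - n) * Z x) \<in> O[F](\<lambda>x. h x ^ 2)" by simp
  with YY have "(\<lambda>x. Y x * Y x + (Y x - n) * Z x) \<in> O[F](\<lambda>x. h x ^ 2)"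
    by (rule sum_in_bigo)
  moreover have "Y x * Y x + (Y x - n) * Z x = (A x - P x) * (D x - P x) - - n\<^sup>2" for x
    by (simp add: Y_def Z_def power2_eq_square algebra_simps)
  ultimately have "(\<lambda>x. (A x - P x) * (D x - P x) - - n\<^sup>2) \<in> O[F](\<lambda>x. h x ^ 2)" by simp
  from bigo_diff_divide[OF this AD h2]
  have "(\<lambda>x. (A x - P x) * (D x - P x) / (D x - A x) - - (n / 2)) \<in> O[F](\<lambda>x. h x ^ 2)"
    using \<open>n \<noteq> 0\<close> by (simp add: power2_eq_square)
  moreover have "\<forall>\<^sub>F x in F. (A x - P x) * (D x - P x) / (D x - A x) - - (n / 2) =
      inverse (1 / (A x - P x) - 1 / (D x - P x)) - - (n / 2)"
  proof -
    have "- n \<noteq> 0" using \<open>n \<noteq> 0\<close> by simp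
    from tendsto_imp_eventually_ne[OF AP this] tendsto_imp_eventually_ne[OF DP \<open>n \<noteq> 0\<close>]
    show ?thesis by eventually_elim (simp add: field_simps)
  qed
  ultimately show ?thesis by (simp only: landau_o.big.in_cong)
qed

text \<open>
  The cross ratio of $(1, -3, -1, 3)$ is $4$, far from the branch cut, so its root is $2 + O(h)$. The
  numerator of the edge point tends to $0$ and the denominator to $8$.
\<close>
lemma edge_point_symmetric_quadruple:
  fixes A B C D h :: "'a \<Rightarrow> complex"
  assumes h: "(h \<longlongrightarrow> 0) F"
    and A: "(\<lambda>x. A x - -3) \<in> O[F](h)" and B: "(\<lambda>x. B x - -1) \<in> O[F](h)"
    and C: "(\<lambda>x. C x - 1) \<in> O[F](h)" and D: "(\<lambda>x. D x - 3) \<in> O[F](h)"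
  obtains P where "P \<in> O[F](h)"
    "\<forall>\<^sub>F x in F. distinct [A x, B x, C x, D x] \<and> edge_point (A x) (B x) (C x) (D x) = Some (P x)"
proof -
  define w where "w x = csqrt (cr (C x) (A x) (B x) (D x))" for x
  define num where "num x = C x * (B x - A x) * w x + B x * (C x - A x)" for x
  define den where "den x = (B x - A x) * w x + (C x - A x)" for x
  note calc = bigo_diff_add bigo_diff_diff bigo_diff_mult bigo_diff_divide A B C D h
  have "(\<lambda>x. cr (C x) (A x) (B x) (D x) - ((1 - -3) * (-1 - 3)) / ((-3 - -1) * (3 - 1))) \<in> O[F](h)"
    unfolding cr_def by (intro calc) simp_all
  then have "(\<lambda>x. cr (C x) (A x) (B x) (D x) - of_real (2\<^sup>2)) \<in> O[F](h)" by simp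
  then have w: "(\<lambda>x. w x - 2) \<in> O[F](h)" using bigo_diff_csqrt[of _ 2] by (simp add: w_def)
  have "(\<lambda>x. num x - (1 * (-1 - -3) * 2 + -1 * (1 - -3))) \<in> O[F](h)"
    unfolding num_def by (intro calc w)
  then have num: "(\<lambda>x. num x - 0) \<in> O[F](h)" by simp
  have "(\<lambda>x. den x - ((-1 - -3) * 2 + (1 - -3))) \<in> O[F](h)"
    unfolding den_def by (intro calc w)
  then have den: "(\<lambda>x. den x - 8) \<in> O[F](h)" by simp
  have P: "(\<lambda>x. num x / den x) \<in> O[F](h)"
    using bigo_diff_divide[OF num den h] by simp
  have neq: "\<forall>\<^sub>F x in F. f x \<noteq> g x"
    if "(\<lambda>x. f x - a) \<in> O[F](h)" "(\<lambda>x. g x - b) \<in> O[F](h)" "a \<noteq> b" for f g :: "'a \<Rightarrow> complex" and a b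
    using tendsto_imp_eventually_ne[OF tendsto_of_bigo_diff[OF bigo_diff_diff[OF that(1,2)] h], of 0] that(3)
    by simp
  have "\<forall>\<^sub>F x in F. den x \<noteq> 0"
    by (rule tendsto_imp_eventually_ne[OF tendsto_of_bigo_diff[OF den h]]) simp
  moreover have "\<forall>\<^sub>F x in F. A x \<noteq> B x" "\<forall>\<^sub>F x in F. A x \<noteq> C x" "\<forall>\<^sub>F x in F. A x \<noteq> D x"
    "\<forall>\<^sub>F x in F. B x \<noteq> C x" "\<forall>\<^sub>F x in F. B x \<noteq> D x" "\<forall>\<^sub>F x in F. C x \<noteq> D x"
    by (rule neq[OF A B] neq[OF A C] neq[OF A D] neq[OF B C] neq[OF B D] neq[OF C D], simp)+
  ultimately have "\<forall>\<^sub>F x in F. distinct [A x, B x, C x, D x] \<and>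
      edge_point (A x) (B x) (C x) (D x) = Some (num x / den x)"
  proof eventually_elim
    case (elim x)
    then show ?case by (simp add: edge_point_def Let_def w_def num_def den_def)
  qed
  with P show ?thesis using that by blast
qed

text \<open>
  The samples in the affine coordinate that moves $s(u)$ to $0$ and the velocity $s'(u)\varepsilon$
  to $1$.
\<close>
lemma normalised_samples:
  assumes "class_C 3 s" "vector_derivative s (at u) \<noteq> 0"
  defines "q \<equiv> \<lambda>k \<epsilon>. (s (u + k * \<epsilon>) - s u) / (vector_derivative s (at u) * of_real \<epsilon>)"
  assumes "k \<noteq> 0"
  shows "(\<lambda>\<epsilon>. q k \<epsilon> - of_real k) \<in> O[at 0](\<lambda>\<epsilon>. of_real \<epsilon>)"
    and "(\<lambda>\<epsilon>. q k \<epsilon> - q (- k) \<epsilon> - 2 * of_real k) \<in> O[at 0](\<lambda>\<epsilon>. of_real \<epsilon> ^ 2)"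
proof -
  define \<sigma> where "\<sigma> = vector_derivative s (at u)"
  have \<sigma>: "\<sigma> \<noteq> 0" using assms(2) by (simp add: \<sigma>_def)
  have "((\<lambda>\<epsilon>. k * \<epsilon>) \<longlongrightarrow> k * 0) (at 0)" by (intro tendsto_intros)
  then have lim: "filterlim (\<lambda>\<epsilon>. k * \<epsilon>) (at 0) (at (0 :: real))"
    using \<open>k \<noteq> 0\<close> by (auto simp: filterlim_at eventually_at intro!: exI[of _ 1])
  have divide: "(\<lambda>\<epsilon>. f \<epsilon> / (\<sigma> * of_real \<epsilon>)) \<in> O[at 0](\<lambda>\<epsilon>. of_real \<epsilon> ^ n)"
    if f: "(\<lambda>\<epsilon>. f \<epsilon>) \<in> O[at 0](\<lambda>\<epsilon>. (of_real (k * \<epsilon>) :: complex) ^ Suc n)" for f :: "real \<Rightarrow> complex" and n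
  proof -
    have "f \<in> O[at 0](\<lambda>\<epsilon>. of_real \<epsilon> ^ Suc n)"
      using f \<open>k \<noteq> 0\<close> by (simp add: power_mult_distrib mult_ac del: power_Suc)
    then have "(\<lambda>\<epsilon>. f \<epsilon> / (\<sigma> * of_real \<epsilon>)) \<in> O[at 0](\<lambda>\<epsilon>. of_real \<epsilon> ^ Suc n / (\<sigma> * of_real \<epsilon>))"
      by (intro landau_o.big.divide_right) (auto simp: \<sigma> eventually_at intro!: exI[of _ 1])
    also have "(\<lambda>\<epsilon>. of_real \<epsilon> ^ Suc n / (\<sigma> * of_real \<epsilon>)) \<in> O[at 0](\<lambda>\<epsilon>. of_real \<epsilon> ^ n)"
      by (intro bigoI[of _ "norm (1 / \<sigma>)"]) (auto simp: norm_mult norm_divide norm_power eventually_at intro!: exI[of _ 1])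
    finally show ?thesis .
  qed
  have "(\<lambda>\<epsilon>. (s (u + k * \<epsilon>) - s u - of_real (k * \<epsilon>) * \<sigma>) / (\<sigma> * of_real \<epsilon>)) \<in> O[at 0](\<lambda>\<epsilon>. of_real \<epsilon> ^ 1)"
    using landau_o.big.compose[OF class_C_3_first_order[OF assms(1), of u] lim]
    by (intro divide) (simp add: \<sigma>_def numeral_2_eq_2)
  moreover have "\<forall>\<^sub>F \<epsilon> in at 0. (s (u + k * \<epsilon>) - s u - of_real (k * \<epsilon>) * \<sigma>) / (\<sigma> * of_real \<epsilon>) = q k \<epsilon> - of_real k"
    using eventually_neq_at_within[of 0]
    by eventually_elim (use \<sigma> in \<open>simp add: q_def \<sigma>_def[symmetric] field_simps\<close>)
  ultimately show "(\<lambda>\<epsilon>. q k \<epsilon> - of_real k) \<in> O[at 0](\<lambda>\<epsilon>. of_real \<epsilon>)"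
    by (simp only: landau_o.big.in_cong power_one_right)
  have "(\<lambda>\<epsilon>. (s (u + k * \<epsilon>) - s (u - k * \<epsilon>) - 2 * of_real (k * \<epsilon>) * \<sigma>) / (\<sigma> * of_real \<epsilon>)) \<in> O[at 0](\<lambda>\<epsilon>. of_real \<epsilon> ^ 2)"
    using landau_o.big.compose[OF class_C_3_symmetric_difference[OF assms(1), of u] lim]
    by (intro divide) (simp add: \<sigma>_def numeral_3_eq_3 numeral_2_eq_2)
  moreover have "\<forall>\<^sub>F \<epsilon> in at 0. (s (u + k * \<epsilon>) - s (u - k * \<epsilon>) - 2 * of_real (k * \<epsilon>) * \<sigma>) / (\<sigma> * of_real \<epsilon>) =
      q k \<epsilon> - q (- k) \<epsilon> - 2 * of_real k"
    using eventually_neq_at_within[of 0]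
    by eventually_elim (use \<sigma> in \<open>simp add: q_def \<sigma>_def[symmetric] field_simps\<close>)
  ultimately show "(\<lambda>\<epsilon>. q k \<epsilon> - q (- k) \<epsilon> - 2 * of_real k) \<in> O[at 0](\<lambda>\<epsilon>. of_real \<epsilon> ^ 2)"
    by (simp only: landau_o.big.in_cong)
qed

text \<open>
  In the normalised coordinate the squared tangent direction is a positive multiple of $R$, which is
  near $3/4$; the principal root then selects the orientation along the curve for both signs of
  $\varepsilon$.
\<close>
lemma discrete_curvature_circle_tangent_asymptotics:
  fixes s :: "real \<Rightarrow> complex" and u :: real
  assumes C3: "class_C 3 s" and reg: "vector_derivative s (at u) \<noteq> 0"
  obtains T0 where
    "\<forall>\<^sub>F \<epsilon> in at 0. let \<gamma> = sampled_curve s u \<epsilon> in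
       distinct [\<gamma> (-1), \<gamma> 0, \<gamma> 1, \<gamma> 2] \<and>
       (\<exists>p. edge_point (\<gamma> (-1)) (\<gamma> 0) (\<gamma> 1) (\<gamma> 2) = Some p \<and>
          unit_tangent_at (discrete_curvature_circle \<gamma> 0) p (T0 \<epsilon>))"
    "(\<lambda>\<epsilon>. T0 \<epsilon> - curve_tangent s u) \<in> O[at 0](\<lambda>\<epsilon>. of_real (\<epsilon>\<^sup>2))"
proof -
  define \<sigma> where "\<sigma> = vector_derivative s (at u)"
  have \<sigma>: "\<sigma> \<noteq> 0" using reg by (simp add: \<sigma>_def)
  define q where "q k \<epsilon> = (s (u + k * \<epsilon>) - s u) / (\<sigma> * of_real \<epsilon>)" for k \<epsilon>
  note q = normalised_samples[OF C3 reg, folded \<sigma>_def, folded q_def]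
  have h: "((\<lambda>\<epsilon>. complex_of_real \<epsilon>) \<longlongrightarrow> 0) (at 0)" by (rule tendsto_eq_intros refl | simp)+
  obtain P where P: "P \<in> O[at 0](\<lambda>\<epsilon>. of_real \<epsilon>)" and
    ev: "\<forall>\<^sub>F \<epsilon> in at 0. distinct [q (-3) \<epsilon>, q (-1) \<epsilon>, q 1 \<epsilon>, q 3 \<epsilon>] \<and>
      edge_point (q (-3) \<epsilon>) (q (-1) \<epsilon>) (q 1 \<epsilon>) (q 3 \<epsilon>) = Some (P \<epsilon>)"
    using edge_point_symmetric_quadruple[OF h, of "q (-3)" "q (-1)" "q 1" "q 3"]
      q(1)[of "-3"] q(1)[of "-1"] q(1)[of 1] q(1)[of 3] by auto
  define H where "H k \<epsilon> = 1 / (q (- k) \<epsilon> - P \<epsilon>) - 1 / (q k \<epsilon> - P \<epsilon>)" for k \<epsilon>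
  define R where "R \<epsilon> = inverse (H 3 \<epsilon>) * inverse (H 1 \<epsilon>)" for \<epsilon>
  have H: "(\<lambda>\<epsilon>. inverse (H k \<epsilon>) - - (of_real k / 2)) \<in> O[at 0](\<lambda>\<epsilon>. of_real \<epsilon> ^ 2)" if "k \<noteq> 0" for k
    unfolding H_def using that q(1)[of "-k"] q(2)[of k] P
    by (intro bigo_symmetric_pair h) auto
  have h2: "((\<lambda>\<epsilon>. complex_of_real \<epsilon> ^ 2) \<longlongrightarrow> 0) (at 0)" using tendsto_power[OF h, of 2] by simp
  have "(\<lambda>\<epsilon>. R \<epsilon> - of_real ((sqrt 3 / 2)\<^sup>2)) \<in> O[at 0](\<lambda>\<epsilon>. of_real \<epsilon> ^ 2)"
    using bigo_diff_mult[OF H[of 3] H[of 1] h2] by (simp add: R_def power_divide)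
  note R = this
  have sqrt: "(\<lambda>\<epsilon>. csqrt (R \<epsilon>) - of_real (sqrt 3 / 2)) \<in> O[at 0](\<lambda>\<epsilon>. of_real \<epsilon> ^ 2)"
    by (rule bigo_diff_csqrt[OF R]) simp
  have sgn: "(\<lambda>\<epsilon>. sgn (csqrt (R \<epsilon>)) - 1) \<in> O[at 0](\<lambda>\<epsilon>. of_real \<epsilon> ^ 2)"
    by (rule bigo_diff_sgn[OF sqrt]) simp
  define T0 where "T0 \<epsilon> = sgn \<sigma> * sgn (csqrt (R \<epsilon>))" for \<epsilon>
  have T: "curve_tangent s u = sgn \<sigma>" by (simp add: curve_tangent_def \<sigma>_def sgn_eq)
  have "(\<lambda>\<epsilon>. sgn \<sigma> * (sgn (csqrt (R \<epsilon>)) - 1)) \<in> O[at 0](\<lambda>\<epsilon>. of_real \<epsilon> ^ 2)"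
    using sgn by simp
  then have T0: "(\<lambda>\<epsilon>. T0 \<epsilon> - curve_tangent s u) \<in> O[at 0](\<lambda>\<epsilon>. of_real (\<epsilon>\<^sup>2))"
    by (simp add: T0_def T right_diff_distrib)
  have "\<forall>\<^sub>F \<epsilon> in at 0. R \<epsilon> \<noteq> 0"
    by (rule tendsto_imp_eventually_ne[OF tendsto_of_bigo_diff[OF R h2]]) simp
  with ev eventually_neq_at_within[of 0]
  have "\<forall>\<^sub>F \<epsilon> in at 0. let \<gamma> = sampled_curve s u \<epsilon> in
       distinct [\<gamma> (-1), \<gamma> 0, \<gamma> 1, \<gamma> 2] \<and>
       (\<exists>p. edge_point (\<gamma> (-1)) (\<gamma> 0) (\<gamma> 1) (\<gamma> 2) = Some p \<and>
          unit_tangent_at (discrete_curvature_circle \<gamma> 0) p (T0 \<epsilon>))"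
  proof eventually_elim
    case (elim \<epsilon>)
    define \<kappa> where "\<kappa> = \<sigma> * of_real \<epsilon>"
    have \<kappa>: "\<kappa> \<noteq> 0" using \<sigma> elim by (simp add: \<kappa>_def)
    define \<gamma> where "\<gamma> = sampled_curve s u \<epsilon>"
    have sq: "s (u + k * \<epsilon>) = s u + \<kappa> * q k \<epsilon>" for k using \<kappa> by (simp add: q_def \<kappa>_def)
    have \<gamma>: "\<gamma> (-1) = s u + \<kappa> * q (-3) \<epsilon>" "\<gamma> 0 = s u + \<kappa> * q (-1) \<epsilon>"
      "\<gamma> 1 = s u + \<kappa> * q 1 \<epsilon>" "\<gamma> 2 = s u + \<kappa> * q 3 \<epsilon>"
      unfolding sq[symmetric] by (simp_all add: \<gamma>_def sampled_curve_def)
    have dist: "distinct [\<gamma> (-1), \<gamma> 0, \<gamma> 1, \<gamma> 2]" unfolding \<gamma> using elim \<kappa> by simp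
    define p where "p = s u + \<kappa> * P \<epsilon>"
    have p: "edge_point (\<gamma> (-1)) (\<gamma> 0) (\<gamma> 1) (\<gamma> 2) = Some p"
      unfolding \<gamma> p_def edge_point_affine[OF \<kappa>] using elim by simp
    have H\<kappa>: "1 / (s u + \<kappa> * q (- k) \<epsilon> - p) - 1 / (s u + \<kappa> * q k \<epsilon> - p) = H k \<epsilon> / \<kappa>" for k
    proof -
      have "s u + \<kappa> * x - p = (x - P \<epsilon>) * \<kappa>" for x by (simp add: p_def algebra_simps)
      then show ?thesis by (simp add: H_def diff_divide_distrib)
    qed
    have unit: "norm (T0 \<epsilon>) = 1" using \<sigma> elim by (simp add: T0_def norm_mult norm_sgn)
    \<comment> \<open>The factor \<open>\<epsilon>\<^sup>2\<close> hidden in \<open>\<kappa>\<^sup>2\<close> is positive, so the sign of \<open>\<epsilon>\<close> does not matter.\<close>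
    define r where "r = 1 / ((norm \<sigma>)\<^sup>2 * (norm (csqrt (R \<epsilon>)))\<^sup>2 * \<epsilon>\<^sup>2)"
    have r: "r > 0" using \<sigma> elim by (simp add: r_def)
    have "(1 / (\<gamma> (-1) - p) - 1 / (\<gamma> 2 - p)) * (1 / (\<gamma> 0 - p) - 1 / (\<gamma> 1 - p)) = inverse (R \<epsilon>) / \<kappa>\<^sup>2"
      unfolding \<gamma> using H\<kappa>[of 3] H\<kappa>[of 1] by (simp add: R_def power2_eq_square)
    moreover have "(T0 \<epsilon>)\<^sup>2 = R \<epsilon> * \<kappa>\<^sup>2 * of_real r"
      using elim by (simp add: T0_def sgn_eq \<kappa>_def r_def power_mult_distrib power_divide del: norm_csqrt)
    ultimately have "(T0 \<epsilon>)\<^sup>2 * ((1 / (\<gamma> (-1) - p) - 1 / (\<gamma> 2 - p)) * (1 / (\<gamma> 0 - p) - 1 / (\<gamma> 1 - p))) = of_real r"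
      using elim \<kappa> by simp
    from unit_tangent_at_curvature_circle[OF dist p unit r this]
    have "unit_tangent_at (discrete_curvature_circle \<gamma> 0) p (T0 \<epsilon>)"
      by (simp add: discrete_curvature_circle_def)
    then show ?case using dist p unfolding \<gamma>_def[symmetric] Let_def by blast
  qed
  with T0 show ?thesis using that by blast
qed

lemma unit_normal_at_if_unit_tangent_at:
  assumes "unit_tangent_at K p v"
  shows "unit_normal_at K p (\<i> * v)"
proof -
  have "norm v = 1" using assms by (simp add: unit_tangent_at_def)
  moreover have "(\<i> * v) \<bullet> v = 0" by (simp add: inner_complex_def)
  ultimately show ?thesis using assms unfolding unit_normal_at_def by (auto simp: norm_mult)
qed

theorem theorem17:
  "\<exists>k::nat. \<forall>(s :: real \<Rightarrow> complex) (u :: real). class_C k s \<and> regular_curve s \<longrightarrow>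
     (\<exists>T0 N0 :: real \<Rightarrow> complex.
        (\<forall>\<^sub>F \<epsilon> in at 0.
           let \<gamma> = sampled_curve s u \<epsilon> in
             distinct [\<gamma> (-1), \<gamma> 0, \<gamma> 1, \<gamma> 2] \<and>
             (\<exists>p. edge_point (\<gamma> (-1)) (\<gamma> 0) (\<gamma> 1) (\<gamma> 2) = Some p \<and>
                  unit_tangent_at (discrete_curvature_circle \<gamma> 0) p (T0 \<epsilon>) \<and>
                  unit_normal_at (discrete_curvature_circle \<gamma> 0) p (N0 \<epsilon>))) \<and>
        (\<lambda>\<epsilon>. T0 \<epsilon> - curve_tangent s u) \<in> O[at 0](\<lambda>\<epsilon>. of_real (\<epsilon>\<^sup>2)) \<and>
        (\<lambda>\<epsilon>. N0 \<epsilon> - curve_normal s u) \<in> O[at 0](\<lambda>\<epsilon>. of_real (\<epsilon>\<^sup>2)))"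
\<comment> \<open>Differentiability of the second derivative is what the cubic error of the symmetric difference requires.\<close>
proof (intro exI[of _ 3] allI impI)
  fix s :: "real \<Rightarrow> complex" and u :: real
  assume s: "class_C 3 s \<and> regular_curve s"
  then have "vector_derivative s (at u) \<noteq> 0" by (simp add: regular_curve_def)
  with s obtain T0 where ev:
    "\<forall>\<^sub>F \<epsilon> in at 0. let \<gamma> = sampled_curve s u \<epsilon> in
       distinct [\<gamma> (-1), \<gamma> 0, \<gamma> 1, \<gamma> 2] \<and>
       (\<exists>p. edge_point (\<gamma> (-1)) (\<gamma> 0) (\<gamma> 1) (\<gamma> 2) = Some p \<and>
          unit_tangent_at (discrete_curvature_circle \<gamma> 0) p (T0 \<epsilon>))"
    and T0: "(\<lambda>\<epsilon>. T0 \<epsilon> - curve_tangent s u) \<in> O[at 0](\<lambda>\<epsilon>. of_real (\<epsilon>\<^sup>2))"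
    using discrete_curvature_circle_tangent_asymptotics[of s u] by blast
  have "(\<lambda>\<epsilon>. \<i> * (T0 \<epsilon> - curve_tangent s u)) \<in> O[at 0](\<lambda>\<epsilon>. of_real (\<epsilon>\<^sup>2))"
    using T0 by simp
  then have N0: "(\<lambda>\<epsilon>. \<i> * T0 \<epsilon> - curve_normal s u) \<in> O[at 0](\<lambda>\<epsilon>. of_real (\<epsilon>\<^sup>2))"
    by (simp add: curve_normal_def curve_tangent_def algebra_simps)
  show "\<exists>T0 N0. (\<forall>\<^sub>F \<epsilon> in at 0.
           let \<gamma> = sampled_curve s u \<epsilon> in
             distinct [\<gamma> (-1), \<gamma> 0, \<gamma> 1, \<gamma> 2] \<and>
             (\<exists>p. edge_point (\<gamma> (-1)) (\<gamma> 0) (\<gamma> 1) (\<gamma> 2) = Some p \<and>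
                  unit_tangent_at (discrete_curvature_circle \<gamma> 0) p (T0 \<epsilon>) \<and>
                  unit_normal_at (discrete_curvature_circle \<gamma> 0) p (N0 \<epsilon>))) \<and>
        (\<lambda>\<epsilon>. T0 \<epsilon> - curve_tangent s u) \<in> O[at 0](\<lambda>\<epsilon>. of_real (\<epsilon>\<^sup>2)) \<and>
        (\<lambda>\<epsilon>. N0 \<epsilon> - curve_normal s u) \<in> O[at 0](\<lambda>\<epsilon>. of_real (\<epsilon>\<^sup>2))"
  proof (intro exI conjI)
    show "\<forall>\<^sub>F \<epsilon> in at 0.
           let \<gamma> = sampled_curve s u \<epsilon> in
             distinct [\<gamma> (-1), \<gamma> 0, \<gamma> 1, \<gamma> 2] \<and>
             (\<exists>p. edge_point (\<gamma> (-1)) (\<gamma> 0) (\<gamma> 1) (\<gamma> 2) = Some p \<and>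
                  unit_tangent_at (discrete_curvature_circle \<gamma> 0) p (T0 \<epsilon>) \<and>
                  unit_normal_at (discrete_curvature_circle \<gamma> 0) p (\<i> * T0 \<epsilon>))"
      using ev unfolding Let_def
      by eventually_elim (use unit_normal_at_if_unit_tangent_at in blast)
  qed (fact T0 N0)+
qed

end
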